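(* Let $n \ge 1$, let $A_1, A_2, A_3, A_4 \in \mathbb{H}^{n\times n}$ be quaternion Hermitian matrices, and let $X \in \mathbb{H}^{n\times n}$ be a quaternion Hermitian positive semidefinite matrix of rank $r$. Then there exist vectors $x_1, \dots, x_r \in \mathbb{H}^n$ such that $$X = \sum_{i=1}^r x_i x_i^H \quad\text{and}\quad x_i^H A_k x_i = \frac{A_k \bullet X}{r} \quad \text{for all } i = 1, \dots, r \text{ and } k = 1,2,3,4.$$
   Context: $\mathbb{H}$ denotes the real quaternions, with basis $1, i, j, k$, where $i^2=j^2=k^2=ijk=-1$; the conjugate of $q = a+bi+cj+dk$ is $\overline{q} = a-bi-cj-dk$ and $\mathrm{Re}\, q = a$. Vectors in $\mathbb{H}^n$ are column vectors. For a quaternion matrix or vector $A$, $A^H = (\overline{A})^\top$ is the conjugate transpose. A square matrix $A \in \mathbb{H}^{n \times n}$ is Hermitian if $A = A^H$; in that case $u^H A u$ is real for every $u \in \mathbb{H}^n$. A Hermitian matrix $X$ is positive semidefinite if $u^H X u \ge 0$ for all $u \in \mathbb{H}^n$. The inner product of $A, B \in \mathbb{H}^{n\times n}$ is $A \bullet B = \mathrm{Re}(\mathrm{tr}(A^H B))$. The rank of a quaternion matrix is the usual one (maximal number of right $\mathbb{H}$-linearly independent columns). *)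

theory Defs
  imports "HOL-Analysis.Analysis"
begin

datatype quat = Quat (qRe: real) (qIm1: real) (qIm2: real) (qIm3: real)

lemma quat_eq_iff:
  "p = q \<longleftrightarrow> qRe p = qRe q \<and> qIm1 p = qIm1 q \<and> qIm2 p = qIm2 q \<and> qIm3 p = qIm3 q"
  by (cases p; cases q) simp

instantiation quat :: ab_group_add
begin

definition "0 = Quat 0 0 0 0"
definition "p + q = Quat (qRe p + qRe q) (qIm1 p + qIm1 q) (qIm2 p + qIm2 q) (qIm3 p + qIm3 q)"
definition "- p = Quat (- qRe p) (- qIm1 p) (- qIm2 p) (- qIm3 p)"
definition "p - q = Quat (qRe p - qRe q) (qIm1 p - qIm1 q) (qIm2 p - qIm2 q) (qIm3 p - qIm3 q)"

instance
  by standard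
    (simp_all add: quat_eq_iff zero_quat_def plus_quat_def uminus_quat_def minus_quat_def)

end

instantiation quat :: real_div_algebra
begin

definition "scaleR r p = Quat (r * qRe p) (r * qIm1 p) (r * qIm2 p) (r * qIm3 p)"

definition "1 = Quat 1 0 0 0"

definition "p * q = Quat
   (qRe p * qRe q - qIm1 p * qIm1 q - qIm2 p * qIm2 q - qIm3 p * qIm3 q)
   (qRe p * qIm1 q + qIm1 p * qRe q + qIm2 p * qIm3 q - qIm3 p * qIm2 q)
   (qRe p * qIm2 q - qIm1 p * qIm3 q + qIm2 p * qRe q + qIm3 p * qIm1 q)
   (qRe p * qIm3 q + qIm1 p * qIm2 q - qIm2 p * qIm1 q + qIm3 p * qRe q)"

definition "inverse p =
   (let N = (qRe p)\<^sup>2 + (qIm1 p)\<^sup>2 + (qIm2 p)\<^sup>2 + (qIm3 p)\<^sup>2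
    in Quat (qRe p / N) (- qIm1 p / N) (- qIm2 p / N) (- qIm3 p / N))"

definition "p div q = p * inverse (q :: quat)"

instance
proof
  fix p q s :: quat and a b :: real
  show "p * q * s = p * (q * s)"
    by (simp add: quat_eq_iff times_quat_def algebra_simps)
  show "(p + q) * s = p * s + q * s" "p * (q + s) = p * q + p * s"
    by (simp_all add: quat_eq_iff times_quat_def plus_quat_def algebra_simps)
  show "1 * p = p" "p * 1 = p"
    by (simp_all add: quat_eq_iff times_quat_def one_quat_def)
  show "(0::quat) \<noteq> 1"
    by (simp add: quat_eq_iff zero_quat_def one_quat_def)
  show "a *\<^sub>R (p + q) = a *\<^sub>R p + a *\<^sub>R q" "(a + b) *\<^sub>R p = a *\<^sub>R p + b *\<^sub>R p"
    "a *\<^sub>R b *\<^sub>R p = (a * b) *\<^sub>R p" "1 *\<^sub>R p = p"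
    by (simp_all add: quat_eq_iff scaleR_quat_def plus_quat_def algebra_simps)
  show "a *\<^sub>R p * q = a *\<^sub>R (p * q)" "p * a *\<^sub>R q = a *\<^sub>R (p * q)"
    by (simp_all add: quat_eq_iff scaleR_quat_def times_quat_def algebra_simps)
  show "inverse (0::quat) = 0"
    by (simp add: inverse_quat_def zero_quat_def)
  show "p div q = p * inverse q"
    by (simp add: divide_quat_def)
  assume "p \<noteq> 0"
  define N where "N = (qRe p)\<^sup>2 + (qIm1 p)\<^sup>2 + (qIm2 p)\<^sup>2 + (qIm3 p)\<^sup>2"
  have "N \<noteq> 0"
    using \<open>p \<noteq> 0\<close> unfolding N_def quat_eq_iff zero_quat_def
    by (simp add: add_nonneg_eq_0_iff)
  then show "inverse p * p = 1" "p * inverse p = 1"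
    unfolding inverse_quat_def times_quat_def one_quat_def N_def[symmetric] Let_def quat_eq_iff
    by (simp_all add: divide_simps) (simp_all add: N_def power2_eq_square algebra_simps)
qed

end

lemma quat_units:
  fixes i j k :: quat
  defines "i \<equiv> Quat 0 1 0 0" and "j \<equiv> Quat 0 0 1 0" and "k \<equiv> Quat 0 0 0 1"
  shows "i\<^sup>2 = - 1" "j\<^sup>2 = - 1" "k\<^sup>2 = - 1" "i * j * k = - 1"
    and "Quat a b c d = a *\<^sub>R 1 + b *\<^sub>R i + c *\<^sub>R j + d *\<^sub>R k"
  by (simp_all add: i_def j_def k_def quat_eq_iff power2_eq_square times_quat_def one_quat_def
      uminus_quat_def plus_quat_def scaleR_quat_def)

definition qcnj :: "quat \<Rightarrow> quat" where
  "qcnj q = Quat (qRe q) (- qIm1 q) (- qIm2 q) (- qIm3 q)"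

definition ctranspose :: "quat ^ 'n ^ 'm \<Rightarrow> quat ^ 'm ^ 'n" where
  "ctranspose A = (\<chi> i j. qcnj (A $ j $ i))"

definition hermitian :: "quat ^ 'n ^ 'n \<Rightarrow> bool" where
  "hermitian A \<longleftrightarrow> A = ctranspose A"

text \<open>For column vectors, \<open>vouter u v\<close> is the matrix $u v^H$ and \<open>vinner u v\<close> is the
  scalar $u^H v$. The order of the factors matters.\<close>

definition vouter :: "quat ^ 'm \<Rightarrow> quat ^ 'n \<Rightarrow> quat ^ 'n ^ 'm" where
  "vouter u v = (\<chi> i j. u $ i * qcnj (v $ j))"

definition vinner :: "quat ^ 'n \<Rightarrow> quat ^ 'n \<Rightarrow> quat" where
  "vinner u v = (\<Sum>i\<in>UNIV. qcnj (u $ i) * v $ i)"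

definition hform :: "quat ^ 'n ^ 'n \<Rightarrow> quat ^ 'n \<Rightarrow> quat" where
  "hform A u = vinner u (A *v u)"

lemma qcnj_simps:
  "qcnj (p + q) = qcnj p + qcnj q" "qcnj (p * q) = qcnj q * qcnj p"
  "qcnj (qcnj q) = q" "qcnj 0 = 0"
  by (simp_all add: qcnj_def quat_eq_iff plus_quat_def times_quat_def zero_quat_def)

lemma qcnj_sum: "qcnj (\<Sum>i\<in>S. f i) = (\<Sum>i\<in>S. qcnj (f i))"
  by (induction S rule: infinite_finite_induct) (simp_all add: qcnj_simps)

lemma of_real_quat: "of_real a = Quat a 0 0 0"
  by (simp add: of_real_def scaleR_quat_def one_quat_def)

lemma qcnj_fixed: "qcnj q = q \<Longrightarrow> q = of_real (qRe q)"
  by (simp add: qcnj_def quat_eq_iff of_real_quat)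

lemma hform_real:
  assumes "hermitian A"
  shows "hform A u = of_real (qRe (hform A u))"
proof (rule qcnj_fixed)
  have cA: "qcnj (A $ i $ j) = A $ j $ i" for i j
  proof -
    have "A $ j $ i = ctranspose A $ j $ i"
      using assms by (simp add: hermitian_def)
    then show ?thesis
      by (simp add: ctranspose_def)
  qed
  have "qcnj (hform A u) = (\<Sum>i\<in>UNIV. \<Sum>j\<in>UNIV. qcnj (u $ j) * A $ j $ i * u $ i)"
    by (simp add: hform_def vinner_def matrix_vector_mult_def qcnj_sum qcnj_simps cA
        sum_distrib_right)
  also have "\<dots> = hform A u"
    by (subst sum.swap)
      (simp add: hform_def vinner_def matrix_vector_mult_def sum_distrib_left mult.assoc)
  finally show "qcnj (hform A u) = hform A u" .
qed

text \<open>By \<open>hform_real\<close>, taking the real part below discards nothing.\<close>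

definition psd :: "quat ^ 'n ^ 'n \<Rightarrow> bool" where
  "psd X \<longleftrightarrow> hermitian X \<and> (\<forall>u. qRe (hform X u) \<ge> 0)"

definition minner :: "quat ^ 'n ^ 'n \<Rightarrow> quat ^ 'n ^ 'n \<Rightarrow> real" where
  "minner A B = qRe (trace (ctranspose A ** B))"

text \<open>The library's \<open>rank\<close> is restricted to matrices over a (commutative) field. Columns are
  selected by index, so a repeated column counts as dependent; scalars act from the right.\<close>

definition right_independent_columns :: "quat ^ 'n ^ 'm \<Rightarrow> 'n set \<Rightarrow> bool" where
  "right_independent_columns A S \<longleftrightarrow>
     (\<forall>c. (\<forall>i. (\<Sum>j\<in>S. A $ i $ j * c j) = 0) \<longrightarrow> (\<forall>j\<in>S. c j = 0))"

definition qrank :: "quat ^ 'n ^ 'm \<Rightarrow> nat" where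
  "qrank A = Max {card S | S. right_independent_columns A S}"

end

theory Submission
  imports Defs "HOL-Library.Quadratic_Discriminant"
begin

text \<open>Splitting off Schur complements writes \<open>X\<close> as a sum of \<open>r\<close> terms \<open>x x\<^sup>H\<close>. Each step lowers
  the rank, so at most \<open>r\<close> steps occur; some terms may be zero, hence linear independence is not
  an issue. A unitary \<open>2 \<times> 2\<close> rotation of two of the vectors preserves the sum. The unit vectors
  of the quaternionic plane map onto a 4-sphere (Hopf fibration), on which four linear functionals
  can be prescribed simultaneously; so a rotation can give the first vector any convex combination
  of the two quadruples of values. To equalise \<open>n + 1\<close> quadruples, equalise the first \<open>n\<close>, rotate
  one of them with the last vector so that the latter attains the overall mean, and equalise the
  first \<open>n\<close> again.\<close>

section \<open>Quaternion vectors and Hermitian forms\<close>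

definition qnorm2 :: "quat \<Rightarrow> real" where
  "qnorm2 q = (qRe q)\<^sup>2 + (qIm1 q)\<^sup>2 + (qIm2 q)\<^sup>2 + (qIm3 q)\<^sup>2"

text \<open>Scalars stand on the right so that they commute with the left action of
  matrices.\<close>

definition rscale :: "quat ^ 'n \<Rightarrow> quat \<Rightarrow> quat ^ 'n" where
  "rscale x b = (\<chi> i. x $ i * b)"

lemma quat_sel [simp]:
  "qRe 0 = 0" "qRe 1 = 1" "qRe (p + q) = qRe p + qRe q" "qRe (p - q) = qRe p - qRe q"
  "qRe (- p) = - qRe p" "qRe (a *\<^sub>R p) = a * qRe p" "qRe (of_real a) = a"
  "qRe (qcnj p) = qRe p"
  by (simp_all add: zero_quat_def one_quat_def plus_quat_def minus_quat_def uminus_quat_def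
      scaleR_quat_def of_real_quat qcnj_def)

lemma qRe_sum: "qRe (\<Sum>i\<in>S. f i) = (\<Sum>i\<in>S. qRe (f i))"
  by (induction S rule: infinite_finite_induct) simp_all

text \<open>Cyclicity under the real part stands in for commutativity.\<close>

lemma qRe_rotate: "qRe (p * (q * s)) = qRe (s * (p * q))"
  by (simp add: times_quat_def algebra_simps)

lemma qcnj_mult_self: "qcnj q * q = of_real (qnorm2 q)" "q * qcnj q = of_real (qnorm2 q)"
  by (simp_all add: qcnj_def times_quat_def of_real_quat qnorm2_def power2_eq_square)

lemma qcnj_simps' [simp]:
  "qcnj (a *\<^sub>R p) = a *\<^sub>R qcnj p" "qcnj (- p) = - qcnj p" "qcnj (p - q) = qcnj p - qcnj q"
  "qcnj 1 = 1" "qcnj (of_real a) = of_real a"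
  by (simp_all add: qcnj_def scaleR_quat_def uminus_quat_def minus_quat_def one_quat_def
      of_real_quat)

declare qcnj_simps [simp]

lemma qnorm2_simps [simp]:
  "qnorm2 0 = 0" "qnorm2 1 = 1" "qnorm2 (- q) = qnorm2 q"
  "qnorm2 (a *\<^sub>R q) = a\<^sup>2 * qnorm2 q" "qnorm2 (qcnj q) = qnorm2 q"
  by (simp_all add: qnorm2_def zero_quat_def one_quat_def uminus_quat_def scaleR_quat_def qcnj_def
      algebra_simps)

lemma qnorm2_nonneg: "qnorm2 q \<ge> 0"
  by (simp add: qnorm2_def)

lemma qnorm2_eq_0_iff [simp]: "qnorm2 q = 0 \<longleftrightarrow> q = 0"
  by (simp add: qnorm2_def quat_eq_iff zero_quat_def add_nonneg_eq_0_iff)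

lemma vinner_add:
  "vinner (x + y) z = vinner x z + vinner y z" "vinner z (x + y) = vinner z x + vinner z y"
  by (simp_all add: vinner_def algebra_simps sum.distrib)

lemma vinner_diff_right: "vinner z (x - y) = vinner z x - vinner z y"
  by (simp add: vinner_def algebra_simps sum_subtractf)

lemma vinner_scaleR:
  "vinner (a *\<^sub>R x) y = a *\<^sub>R vinner x y" "vinner x (a *\<^sub>R y) = a *\<^sub>R vinner x y"
  by (simp_all add: vinner_def scaleR_sum_right)

lemma vinner_rscale:
  "vinner (rscale x b) y = qcnj b * vinner x y" "vinner x (rscale y b) = vinner x y * b"
  by (simp_all add: vinner_def rscale_def sum_distrib_left sum_distrib_right mult.assoc)

lemma vinner_axis: "vinner (axis p 1) y = y $ p"
proof -
  have "qcnj (axis p 1 $ i) * y $ i = (if i = p then y $ i else 0)" for i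
    by (simp add: axis_def)
  then show ?thesis
    by (simp add: vinner_def)
qed

lemma matrix_vector_rscale: "A *v rscale x b = rscale (A *v x) b"
  by (simp add: matrix_vector_mult_def rscale_def vec_eq_iff sum_distrib_right mult.assoc)

lemma matrix_vector_scaleR_quat: "A *v (a *\<^sub>R x) = a *\<^sub>R (A *v x)"
  for A :: "quat ^ 'n ^ 'm"
  by (simp add: matrix_vector_mult_def vec_eq_iff scaleR_sum_right)

lemma matrix_vector_axis: "(A *v axis p 1) $ i = A $ i $ p" for A :: "quat ^ 'n ^ 'm"
proof -
  have "A $ i $ j * axis p 1 $ j = (if j = p then A $ i $ j else 0)" for j
    by (simp add: axis_def)
  then show ?thesis
    by (simp add: matrix_vector_mult_def)
qed

lemma hermitian_cnj:
  assumes "hermitian A"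
  shows "qcnj (A $ i $ j) = A $ j $ i"
proof -
  have "A $ j $ i = ctranspose A $ j $ i"
    using assms by (simp add: hermitian_def)
  then show ?thesis by (simp add: ctranspose_def)
qed

lemma hermitian_vinner_swap:
  assumes "hermitian A"
  shows "vinner y (A *v x) = qcnj (vinner x (A *v y))"
proof -
  have "qcnj (vinner x (A *v y)) = (\<Sum>i\<in>UNIV. \<Sum>j\<in>UNIV. qcnj (y $ j) * A $ j $ i * x $ i)"
    by (simp add: vinner_def matrix_vector_mult_def qcnj_sum hermitian_cnj[OF assms]
        sum_distrib_right)
  also have "\<dots> = vinner y (A *v x)"
    by (subst sum.swap) (simp add: vinner_def matrix_vector_mult_def sum_distrib_left mult.assoc)
  finally show ?thesis ..
qed

text \<open>The two cross terms are conjugate to each other, so their real parts agree.\<close>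

lemma hform_add:
  assumes "hermitian A"
  shows "qRe (hform A (x + y)) = qRe (hform A x) + qRe (hform A y) + 2 * qRe (vinner x (A *v y))"
  using hermitian_vinner_swap[OF assms, of y x]
  by (simp add: hform_def vinner_add matrix_vector_right_distrib)

lemma hform_scaleR: "qRe (hform A (a *\<^sub>R x)) = a\<^sup>2 * qRe (hform A x)"
  by (simp add: hform_def vinner_scaleR matrix_vector_scaleR_quat power2_eq_square)

lemma hform_rscale:
  assumes "hermitian A"
  shows "qRe (hform A (rscale x b)) = qnorm2 b * qRe (hform A x)"
proof -
  have "hform A (rscale x b) = qcnj b * (hform A x * b)"
    by (simp add: hform_def vinner_rscale matrix_vector_rscale mult.assoc)
  also have "qRe \<dots> = qRe (hform A x * (b * qcnj b))"
    by (rule qRe_rotate[symmetric])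
  also have "\<dots> = qRe (qnorm2 b *\<^sub>R hform A x)"
    by (simp add: qcnj_mult_self of_real_def)
  finally show ?thesis by simp
qed

section \<open>The trace inner product on sums of outer products\<close>

lemma minner_add: "minner A (B + C) = minner A B + minner A C"
  by (simp add: minner_def trace_def matrix_matrix_mult_def algebra_simps sum.distrib)

lemma minner_sum: "minner A (\<Sum>i\<in>S. f i) = (\<Sum>i\<in>S. minner A (f i))"
proof (induction S rule: infinite_finite_induct)
  case (insert x F)
  then show ?case by (simp add: minner_add)
qed (simp_all add: minner_def trace_def matrix_matrix_mult_def)

lemma minner_vouter:
  assumes "hermitian A"
  shows "minner A (vouter u u) = qRe (hform A u)"
proof -
  have "ctranspose A = A"
    using assms by (simp add: hermitian_def)
  then have "minner A (vouter u u)
      = (\<Sum>i\<in>UNIV. \<Sum>j\<in>UNIV. qRe (A $ i $ j * (u $ j * qcnj (u $ i))))"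
    by (simp add: minner_def trace_def matrix_matrix_mult_def vouter_def qRe_sum)
  also have "\<dots> = (\<Sum>i\<in>UNIV. \<Sum>j\<in>UNIV. qRe (qcnj (u $ i) * (A $ i $ j * u $ j)))"
    by (intro sum.cong refl qRe_rotate)
  also have "\<dots> = qRe (hform A u)"
    by (simp add: hform_def vinner_def matrix_vector_mult_def qRe_sum sum_distrib_left)
  finally show ?thesis .
qed

section \<open>Rank decomposition\<close>

text \<open>With zero diagonal, only the cross term survives at e_i + e_j b. The choice b =
  \<open>- qcnj (X $ i $ j)\<close> makes it -2 |X_ij|^2, which positivity allows only for X_ij =
  0.\<close>

lemma psd_diag_zero_imp_zero:
  assumes "psd X" and diag: "\<And>p. X $ p $ p = 0"
  shows "X = 0"
proof -
  have herm: "hermitian X" using assms by (simp add: psd_def)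
  have "X $ i $ j = 0" for i j
  proof -
    define e where "e = (axis i 1 :: quat ^ 'a)"
    define f where "f = rscale (axis j 1 :: quat ^ 'a) (- qcnj (X $ i $ j))"
    have "qRe (hform X e) = 0"
      by (simp add: e_def hform_def vinner_axis matrix_vector_axis diag)
    moreover have "qRe (hform X f) = 0"
      by (simp add: f_def hform_rscale[OF herm])
        (simp add: hform_def vinner_axis matrix_vector_axis diag)
    moreover have "vinner e (X *v f) = - of_real (qnorm2 (X $ i $ j))"
      by (simp add: e_def f_def matrix_vector_rscale vinner_rscale vinner_axis
          matrix_vector_axis qcnj_mult_self)
    ultimately have "qRe (hform X (e + f)) = - 2 * qnorm2 (X $ i $ j)"
      by (simp add: hform_add[OF herm])
    then have "qnorm2 (X $ i $ j) \<le> 0"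
      using assms(1) by (smt (verit) psd_def)
    then show ?thesis
      using qnorm2_nonneg[of "X $ i $ j"] by simp
  qed
  then show ?thesis by (simp add: vec_eq_iff)
qed

section \<open>Column rank and Schur complements\<close>

lemma finite_qrank_set: "finite {card S | S. right_independent_columns A S}"
  by (rule finite_subset[of _ "card ` UNIV"]) auto

lemma qrank_ge: "right_independent_columns A S \<Longrightarrow> card S \<le> qrank A"
  unfolding qrank_def by (rule Max_ge[OF finite_qrank_set]) auto

lemma qrank_witness: "\<exists>S. right_independent_columns A S \<and> card S = qrank A"
proof -
  have "right_independent_columns A {}" by (simp add: right_independent_columns_def)
  then have "qrank A \<in> {card S | S. right_independent_columns A S}"
    unfolding qrank_def by (intro Max_in finite_qrank_set) blast
  then show ?thesis by auto
qed

text \<open>Take \<open>x\<close> to be column \<open>p\<close> divided by the square root of its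
  diagonal entry. Subtracting its outer product clears row and column \<open>p\<close>, and
  \<open>p\<close> can be added to any set of columns independent in the remainder to give one
  independent in \<open>X\<close>.\<close>

lemma psd_schur:
  fixes X :: "quat ^ 'n ^ 'n"
  assumes "psd X" and p: "X $ p $ p \<noteq> 0"
  obtains x where "psd (X - vouter x x)" "qrank (X - vouter x x) < qrank X"
proof -
  have herm: "hermitian X" using assms by (simp add: psd_def)
  define d where "d = qRe (X $ p $ p)"
  have hp: "hform X (axis p 1) = X $ p $ p"
    by (simp add: hform_def vinner_axis matrix_vector_axis)
  then have Xpp: "X $ p $ p = of_real d"
    using hform_real[OF herm, of "axis p 1"] by (simp add: d_def)
  moreover have "d \<ge> 0"
    using assms(1) hp by (metis d_def psd_def)
  ultimately have d: "d > 0" using p by (cases "d = 0") auto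
  define x :: "quat ^ 'n" where "x = (1 / sqrt d) *\<^sub>R (X *v axis p 1)"
  define Y where "Y = X - vouter x x"
  have Yij: "Y $ i $ j = X $ i $ j - (1 / d) *\<^sub>R (X $ i $ p * X $ p $ j)" for i j
    using d by (simp add: Y_def vouter_def x_def matrix_vector_axis hermitian_cnj[OF herm]
        real_sqrt_mult_self divide_simps)
  have Yp: "Y $ p $ j = 0" "Y $ j $ p = 0" for j
    using d by (simp_all add: Yij Xpp of_real_def)
  have "hermitian Y"
    unfolding hermitian_def ctranspose_def
    by (simp add: vec_eq_iff Yij hermitian_cnj[OF herm])
  moreover have "qRe (hform Y u) \<ge> 0" for u
  proof -
    define z where "z = (X *v u) $ p"
    \<comment> \<open>Completing the square: moving \<open>u\<close> along the axis \<open>p\<close>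
      by this amount minimises the form of \<open>X\<close>, and the minimum is the form of
      \<open>Y\<close> at \<open>u\<close>.\<close>
    define f where "f = rscale (axis p 1 :: quat ^ 'n) (- ((1 / d) *\<^sub>R z))"
    have row: "(\<Sum>j\<in>UNIV. X $ p $ j * u $ j) = z"
      by (simp add: z_def matrix_vector_mult_def)
    have "vinner u (X *v axis p 1) = qcnj z"
      using hermitian_vinner_swap[OF herm, of u "axis p 1"] by (simp add: vinner_axis z_def)
    then have uf: "vinner u (X *v f) = - ((1 / d) *\<^sub>R of_real (qnorm2 z))"
      by (simp add: f_def matrix_vector_rscale vinner_rscale qcnj_mult_self)
    have "(Y *v u) = X *v u - (1 / d) *\<^sub>R rscale (X *v axis p 1) z"
      by (simp add: vec_eq_iff matrix_vector_mult_def[of Y] matrix_vector_mult_def[of X u] Yij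
          left_diff_distrib sum_subtractf rscale_def matrix_vector_axis
          scaleR_sum_right[symmetric] mult.assoc sum_distrib_left[symmetric] row)
    then have "hform Y u = hform X u - (1 / d) *\<^sub>R (qcnj z * z)"
      using \<open>vinner u (X *v axis p 1) = qcnj z\<close>
      by (simp add: hform_def vinner_diff_right vinner_scaleR vinner_rscale)
    then have "qRe (hform Y u) = qRe (hform X u) - qnorm2 z / d"
      by (simp add: qcnj_mult_self)
    moreover have "qRe (hform X (u + f)) = qRe (hform X u) - qnorm2 z / d"
      using d by (simp add: hform_add[OF herm] uf)
        (simp add: f_def hform_rscale[OF herm] hp Xpp power2_eq_square)
    moreover have "qRe (hform X (u + f)) \<ge> 0"
      using assms(1) by (simp add: psd_def)
    ultimately show ?thesis by simp
  qed
  ultimately have "psd Y" by (simp add: psd_def)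
  moreover have "qrank Y < qrank X"
  proof -
    obtain S where S: "right_independent_columns Y S" and card: "card S = qrank Y"
      using qrank_witness by blast
    have "p \<notin> S"
    proof
      assume "p \<in> S"
      \<comment> \<open>Column \<open>p\<close> of \<open>Y\<close> is zero, so this is a nontrivial
        relation.\<close>
      define c :: "'n \<Rightarrow> quat" where "c j = (if j = p then 1 else 0)" for j
      have "(\<Sum>j\<in>S. Y $ i $ j * c j) = 0" for i
        by (rule sum.neutral) (simp add: Yp c_def)
      then have "c p = 0"
        using S \<open>p \<in> S\<close> unfolding right_independent_columns_def by blast
      then show False by (simp add: c_def)
    qed
    have "right_independent_columns X (insert p S)"
      unfolding right_independent_columns_def
    proof (intro allI impI)
      fix c assume 0: "\<forall>i. (\<Sum>j\<in>insert p S. X $ i $ j * c j) = 0"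
      \<comment> \<open>Expressing the columns of \<open>X\<close> through those of \<open>Y\<close>
        and column \<open>p\<close>, \<open>w\<close> is the total coefficient of column
        \<open>p\<close>.\<close>
      define w where "w = c p + (1 / d) *\<^sub>R (\<Sum>j\<in>S. X $ p $ j * c j)"
      have "(\<Sum>j\<in>insert p S. X $ i $ j * c j) = (\<Sum>j\<in>S. Y $ i $ j * c j) + X $ i $ p * w" for i
        using \<open>p \<notin> S\<close> by (simp add: Yij w_def left_diff_distrib sum_subtractf distrib_left
            scaleR_sum_right sum_distrib_left mult.assoc)
      then have eq: "(\<Sum>j\<in>S. Y $ i $ j * c j) + X $ i $ p * w = 0" for i
        using 0 by simp
      \<comment> \<open>Row \<open>p\<close> of \<open>Y\<close> vanishes, which leaves only
        \<open>X $ p $ p * w\<close>.\<close>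
      have "w = 0"
        using eq[of p] p by (simp add: Yp)
      then have cS: "\<forall>j\<in>S. c j = 0"
        using eq S by (simp add: right_independent_columns_def)
      then show "\<forall>j\<in>insert p S. c j = 0"
        using \<open>w = 0\<close> by (simp add: w_def)
    qed
    from qrank_ge[OF this] show ?thesis
      using \<open>p \<notin> S\<close> card by simp
  qed
  ultimately show ?thesis using that Y_def by blast
qed

text \<open>The inequality lets the induction go through even if a step lowers the rank by more than
  one; zero vectors fill up the sum.\<close>

lemma psd_sum_vouter:
  fixes X :: "quat ^ 'n ^ 'n"
  assumes "psd X" "qrank X \<le> r"
  shows "\<exists>x. X = (\<Sum>i<r. vouter (x i) (x i))"
  using assms
proof (induction r arbitrary: X)
  case 0
  have "X $ p $ p = 0" for p
  proof (rule ccontr)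
    assume "X $ p $ p \<noteq> 0"
    then obtain x where "qrank (X - vouter x x) < qrank X"
      using psd_schur \<open>psd X\<close> by blast
    then show False using 0 by simp
  qed
  then have "X = 0"
    using psd_diag_zero_imp_zero \<open>psd X\<close> by blast
  then show ?case by simp
next
  case (Suc r)
  show ?case
  proof (cases "\<forall>p. X $ p $ p = 0")
    case True
    then have "X = 0" using Suc.prems psd_diag_zero_imp_zero by blast
    moreover have "vouter (0 :: quat ^ 'n) (0 :: quat ^ 'n) = 0"
      by (simp add: vouter_def vec_eq_iff)
    ultimately have "X = (\<Sum>i<Suc r. vouter (0 :: quat ^ 'n) 0)" by simp
    then show ?thesis by (intro exI[of _ "\<lambda>_. 0"])
  next
    case False
    then obtain y where y: "psd (X - vouter y y)" "qrank (X - vouter y y) < qrank X"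
      using psd_schur \<open>psd X\<close> by blast
    then obtain x where "X - vouter y y = (\<Sum>i<r. vouter (x i) (x i))"
      using Suc.IH[of "X - vouter y y"] Suc.prems by auto
    then have "X = (\<Sum>i<Suc r. vouter ((x(r := y)) i) ((x(r := y)) i))"
      by (simp add: algebra_simps)
    then show ?thesis by blast
  qed
qed

section \<open>Equalising four forms\<close>

text \<open>A linear map from R^5 to R^4 has a nonzero kernel vector. It will be the direction of a
  line of admissible rotation parameters.\<close>

lemma four_equations_five_unknowns:
  fixes m :: "nat \<Rightarrow> quat" and g :: "nat \<Rightarrow> real"
  obtains \<sigma> \<omega> where "\<sigma> \<noteq> 0 \<or> \<omega> \<noteq> 0"
    "\<And>k. k \<in> {1..4} \<Longrightarrow> \<sigma> * g k + 2 * qRe (m k * \<omega>) = 0"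
proof -
  define h :: "nat \<Rightarrow> real \<times> real \<times> real \<times> real \<times> real \<Rightarrow> real" where
    "h k = (\<lambda>(s, a, b, c, d). s * g k + 2 * qRe (m k * Quat a b c d))" for k
  define f where "f v = (h 1 v, h 2 v, h 3 v, h 4 v)" for v
  have h: "linear (h k)" for k
    by (rule linearI)
      (simp_all add: h_def times_quat_def split_beta distrib_left distrib_right right_diff_distrib
        left_diff_distrib)
  have "linear f"
    by (rule linearI) (simp_all add: f_def linear_add[OF h] linear_scale[OF h])
  have "\<not> inj f"
  proof
    assume "inj f"
    then have "dim (range f) = DIM(real \<times> real \<times> real \<times> real \<times> real)"
      using dim_image_eq[OF \<open>linear f\<close>, of UNIV] by simp
    then show False
      using dim_subset_UNIV[of "range f"] by simp
  qed
  then obtain v where v: "f v = 0" "v \<noteq> 0"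
    using linear_injective_0[OF \<open>linear f\<close>] by blast
  obtain s a b c d where vs: "v = (s, a, b, c, d)" by (cases v)
  show ?thesis
  proof
    show "s \<noteq> 0 \<or> Quat a b c d \<noteq> 0"
      using v(2) vs by (auto simp: zero_quat_def zero_prod_def)
    fix k :: nat assume "k \<in> {1..4}"
    then have "k = 1 \<or> k = 2 \<or> k = 3 \<or> k = 4" by auto
    then have "h k v = 0"
      using v(1) by (auto simp: f_def zero_prod_def)
    then show "s * g k + 2 * qRe (m k * Quat a b c d) = 0"
      by (simp add: h_def vs)
  qed
qed

lemma quadratic_root_exists:
  fixes a b c :: real
  assumes "a > 0" "c \<ge> 0"
  obtains l where "a * l\<^sup>2 + b * l - c = 0"
proof -
  have "discrim a b (- c) \<ge> 0" using assms by (simp add: discrim_def)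
  then obtain l where "a * l\<^sup>2 + b * l + - c = 0"
    using discriminant_nonneg_ex[of a b "- c"] assms by auto
  then show ?thesis using that by simp
qed

text \<open>The row (x, y) is multiplied on the right by the matrix with rows (a, -conj b) and (b,
  a), which is unitary; the mixed terms cancel because \<open>a\<close> is real.\<close>

lemma vouter_rotate:
  assumes "a\<^sup>2 + qnorm2 b = 1"
  shows "vouter (a *\<^sub>R x + rscale y b) (a *\<^sub>R x + rscale y b)
       + vouter (a *\<^sub>R y - rscale x (qcnj b)) (a *\<^sub>R y - rscale x (qcnj b))
       = vouter x x + vouter y y"
proof -
  have "(a *\<^sub>R p + q * b) * qcnj (a *\<^sub>R s + t * b)
      + (a *\<^sub>R q - p * qcnj b) * qcnj (a *\<^sub>R t - s * qcnj b) = p * qcnj s + q * qcnj t" for p q s t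
  proof -
    have "(a *\<^sub>R p + q * b) * qcnj (a *\<^sub>R s + t * b)
      + (a *\<^sub>R q - p * qcnj b) * qcnj (a *\<^sub>R t - s * qcnj b)
      = a\<^sup>2 *\<^sub>R (p * qcnj s) + p * (qcnj b * b) * qcnj s
        + (a\<^sup>2 *\<^sub>R (q * qcnj t) + q * (b * qcnj b) * qcnj t)"
      by (simp add: algebra_simps power2_eq_square)
    also have "\<dots> = (a\<^sup>2 + qnorm2 b) *\<^sub>R (p * qcnj s) + (a\<^sup>2 + qnorm2 b) *\<^sub>R (q * qcnj t)"
      by (simp add: qcnj_mult_self of_real_def scaleR_add_left)
    finally show ?thesis using assms by simp
  qed
  then show ?thesis
    by (simp add: vouter_def vec_eq_iff rscale_def)
qed

text \<open>In terms of \<open>s = a\<^sup>2\<close> and \<open>w = a b\<close>, the requirements on the rotation are four linear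
  equations together with the ellipsoid \<open>\<bar>w\<bar>\<^sup>2 = s (1 - s)\<close>. The equations hold at \<open>(s, w) = (t, 0)\<close>,
  which is enclosed by the ellipsoid, hence along a line through that point, and this line meets
  the ellipsoid.\<close>

lemma rotate_pair:
  fixes A :: "nat \<Rightarrow> quat ^ 'n ^ 'n"
  assumes herm: "\<And>k. k \<in> {1..4} \<Longrightarrow> hermitian (A k)" and t: "0 \<le> t" "t \<le> 1"
  obtains x' y' where "vouter x' x' + vouter y' y' = vouter x x + vouter y y"
    "\<And>k. k \<in> {1..4} \<Longrightarrow>
      qRe (hform (A k) x') = t * qRe (hform (A k) x) + (1 - t) * qRe (hform (A k) y)"
proof -
  define g where "g k = qRe (hform (A k) x) - qRe (hform (A k) y)" for k
  define m where "m k = vinner x (A k *v y)" for k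
  obtain \<sigma> \<omega> where nz: "\<sigma> \<noteq> 0 \<or> \<omega> \<noteq> 0"
    and lin: "\<And>k. k \<in> {1..4} \<Longrightarrow> \<sigma> * g k + 2 * qRe (m k * \<omega>) = 0"
    using four_equations_five_unknowns by blast
  have "qnorm2 \<omega> + \<sigma>\<^sup>2 > 0"
    using nz qnorm2_nonneg[of \<omega>] by (smt (verit) qnorm2_eq_0_iff zero_less_power2 zero_le_power2)
  \<comment> \<open>This is |w|^2 = s (1 - s) along the line s = t + l \<sigma>, w = l
    \<omega>.\<close>
  then obtain l where l: "(qnorm2 \<omega> + \<sigma>\<^sup>2) * l\<^sup>2 + ((2 * t - 1) * \<sigma>) * l - t * (1 - t) = 0"
    using quadratic_root_exists[of "qnorm2 \<omega> + \<sigma>\<^sup>2" "t * (1 - t)"] t by auto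
  define s where "s = t + l * \<sigma>"
  define w where "w = l *\<^sub>R \<omega>"
  have w: "qnorm2 w = s * (1 - s)"
    using l by (simp add: w_def s_def algebra_simps power2_eq_square)
  have lin': "(s - t) * g k + 2 * qRe (m k * w) = 0" if "k \<in> {1..4}" for k
  proof -
    have "(s - t) * g k + 2 * qRe (m k * w) = l * (\<sigma> * g k + 2 * qRe (m k * \<omega>))"
      by (simp add: s_def w_def algebra_simps)
    then show ?thesis using lin[OF that] by simp
  qed
  have s: "0 \<le> s" "s \<le> 1"
    using w qnorm2_nonneg[of w] by (auto simp: zero_le_mult_iff)
  \<comment> \<open>Recovers the rotation from \<open>s\<close> and \<open>w\<close>: divide by
    \<open>sqrt s\<close>, or, if \<open>s = 0\<close> and so \<open>w = 0\<close>, take any unit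
    \<open>b\<close>.\<close>
  obtain a b where ab: "a\<^sup>2 = s" "qnorm2 b = 1 - s" "a *\<^sub>R b = w"
  proof (cases "s = 0")
    case True
    then have "w = 0" using w by simp
    then show ?thesis using that[of 0 1] True by simp
  next
    case False
    then show ?thesis
      using that[of "sqrt s" "(1 / sqrt s) *\<^sub>R w"] s w by (simp add: power_divide)
  qed
  show ?thesis
  proof
    show "vouter (a *\<^sub>R x + rscale y b) (a *\<^sub>R x + rscale y b)
       + vouter (a *\<^sub>R y - rscale x (qcnj b)) (a *\<^sub>R y - rscale x (qcnj b))
       = vouter x x + vouter y y"
      by (rule vouter_rotate) (simp add: ab)
    fix k :: nat assume k: "k \<in> {1..4}"
    have "vinner (a *\<^sub>R x) (A k *v rscale y b) = m k * (a *\<^sub>R b)"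
      by (simp add: m_def vinner_scaleR matrix_vector_rscale vinner_rscale)
    then have "qRe (hform (A k) (a *\<^sub>R x + rscale y b))
        = s * qRe (hform (A k) x) + (1 - s) * qRe (hform (A k) y) + 2 * qRe (m k * w)"
      using herm[OF k] by (simp add: hform_add hform_scaleR hform_rscale ab)
    also have "\<dots> = t * qRe (hform (A k) x) + (1 - t) * qRe (hform (A k) y)"
      using lin'[OF k] by (simp add: g_def algebra_simps)
    finally show "qRe (hform (A k) (a *\<^sub>R x + rscale y b))
        = t * qRe (hform (A k) x) + (1 - t) * qRe (hform (A k) y)" .
  qed
qed

text \<open>Counting by \<open>Suc n\<close> keeps the family nonempty, and multiplying through by
  the count avoids division.\<close>

lemma equalise_forms:
  fixes A :: "nat \<Rightarrow> quat ^ 'n ^ 'n"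
  assumes herm: "\<And>k. k \<in> {1..4} \<Longrightarrow> hermitian (A k)"
  shows "\<exists>y. (\<Sum>i<Suc n. vouter (y i) (y i)) = (\<Sum>i<Suc n. vouter (x i) (x i)) \<and>
    (\<forall>i<Suc n. \<forall>k\<in>{1..4}. real (Suc n) * qRe (hform (A k) (y i))
        = (\<Sum>j<Suc n. qRe (hform (A k) (x j))))"
proof (induction n arbitrary: x)
  case 0
  show ?case by (rule exI[of _ x]) simp
next
  case (Suc n)
  let ?V = "\<lambda>k x. qRe (hform (A k) x)"
  define N where "N = real (Suc n)"
  have N: "N > 0" "real (Suc (Suc n)) = N + 1" by (simp_all add: N_def)
  \<comment> \<open>\<open>N\<close> times the value at \<open>y n\<close> is the total over the
    first \<open>N\<close> vectors, so this weight gives \<open>u\<close> the overall mean.\<close>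
  define t where "t = 1 / (N + 1)"
  have t: "0 \<le> t" "t \<le> 1" and Nt: "(N + 1) * t = 1"
    using N(1) by (simp_all add: t_def)
  obtain y where ysum: "(\<Sum>i<Suc n. vouter (y i) (y i)) = (\<Sum>i<Suc n. vouter (x i) (x i))"
    and y: "\<And>i k. i < Suc n \<Longrightarrow> k \<in> {1..4} \<Longrightarrow> N * ?V k (y i) = (\<Sum>j<Suc n. ?V k (x j))"
    using Suc.IH[of x] unfolding N_def by blast
  obtain u v where uv: "vouter u u + vouter v v = vouter (x (Suc n)) (x (Suc n)) + vouter (y n) (y n)"
    and u: "\<And>k. k \<in> {1..4} \<Longrightarrow>
      ?V k u = t * ?V k (x (Suc n)) + (1 - t) * ?V k (y n)"
    using rotate_pair[where A = A and x = "x (Suc n)" and y = "y n", OF herm t] by blast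
  have Vadd: "?V k u + ?V k v = ?V k (x (Suc n)) + ?V k (y n)" if "k \<in> {1..4}" for k
    using arg_cong[OF uv, of "minner (A k)"] herm[OF that]
    by (simp add: minner_add minner_vouter)
  have Vu: "(N + 1) * ?V k u = (\<Sum>j<Suc (Suc n). ?V k (x j))" if "k \<in> {1..4}" for k
  proof -
    have "(N + 1) * ?V k u
        = ((N + 1) * t) * ?V k (x (Suc n)) + (N + 1 - (N + 1) * t) * ?V k (y n)"
      unfolding u[OF that] by (simp add: algebra_simps)
    then have "(N + 1) * ?V k u = ?V k (x (Suc n)) + N * ?V k (y n)"
      by (simp add: Nt)
    then show ?thesis using y[of n k] that by simp
  qed
  \<comment> \<open>Replacing \<open>y n\<close> by \<open>v\<close> spoils the equality among the
    first \<open>N\<close> vectors; the induction hypothesis restores it.\<close>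
  obtain z where zsum: "(\<Sum>i<Suc n. vouter (z i) (z i))
      = (\<Sum>i<Suc n. vouter ((y(n := v)) i) ((y(n := v)) i))"
    and z: "\<And>i k. i < Suc n \<Longrightarrow> k \<in> {1..4} \<Longrightarrow>
      N * ?V k (z i) = (\<Sum>j<Suc n. ?V k ((y(n := v)) j))"
    using Suc.IH[of "y(n := v)"] unfolding N_def by blast
  have Vz: "(N + 1) * ?V k (z i) = (\<Sum>j<Suc (Suc n). ?V k (x j))"
    if i: "i < Suc n" and k: "k \<in> {1..4}" for i k
  proof -
    have "(\<Sum>j<n. ?V k (y j)) + ?V k (y n) = (\<Sum>j<Suc n. ?V k (x j))"
      using arg_cong[OF ysum, of "minner (A k)"] herm[OF k]
      by (simp add: minner_add minner_sum minner_vouter)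
    then have "N * ?V k (z i) = (\<Sum>j<Suc (Suc n). ?V k (x j)) - ?V k u"
      using z[OF i k] Vadd[OF k] by simp
    \<comment> \<open>Removing a vector that attains the mean leaves the mean of the others
      unchanged.\<close>
    also have "\<dots> = N * ?V k u"
      using Vu[OF k] by (simp add: algebra_simps)
    finally show ?thesis using N(1) Vu[OF k] by simp
  qed
  have "(\<Sum>i<Suc (Suc n). vouter ((z(Suc n := u)) i) ((z(Suc n := u)) i))
      = (\<Sum>i<n. vouter (y i) (y i)) + (vouter u u + vouter v v)"
    using zsum by (simp add: add_ac)
  also have "\<dots> = (\<Sum>i<Suc n. vouter (y i) (y i)) + vouter (x (Suc n)) (x (Suc n))"
    unfolding uv by (simp add: add_ac)
  also have "\<dots> = (\<Sum>i<Suc (Suc n). vouter (x i) (x i))"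
    unfolding ysum by simp
  finally have "(\<Sum>i<Suc (Suc n). vouter ((z(Suc n := u)) i) ((z(Suc n := u)) i))
      = (\<Sum>i<Suc (Suc n). vouter (x i) (x i))" .
  moreover have "(N + 1) * ?V k ((z(Suc n := u)) i) = (\<Sum>j<Suc (Suc n). ?V k (x j))"
    if "i < Suc (Suc n)" "k \<in> {1..4}" for i k
    using that Vz[of i k] Vu[of k] by (cases "i = Suc n") auto
  ultimately show ?case unfolding N(2) by blast
qed

theorem theorem1:
  fixes A :: "nat \<Rightarrow> quat ^ 'n ^ 'n"
    and X :: "quat ^ 'n ^ 'n"
    and r :: nat
  assumes "\<And>k. k \<in> {1..4} \<Longrightarrow> hermitian (A k)"
    and "psd X"
    and "qrank X = r"
  shows "\<exists>x :: nat \<Rightarrow> quat ^ 'n.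
           X = (\<Sum>i = 1..r. vouter (x i) (x i)) \<and>
           (\<forall>i\<in>{1..r}. \<forall>k\<in>{1..4}. hform (A k) (x i) = of_real (minner (A k) X / real r))"
proof -
  obtain x where x: "X = (\<Sum>i<r. vouter (x i) (x i))"
    using psd_sum_vouter assms by blast
  show ?thesis
  proof (cases r)
    case 0
    then show ?thesis using x by simp
  next
    case (Suc n)
    obtain y where ysum: "(\<Sum>i<r. vouter (y i) (y i)) = X"
      and y: "\<And>i k. i < r \<Longrightarrow> k \<in> {1..4} \<Longrightarrow>
        real r * qRe (hform (A k) (y i)) = (\<Sum>j<r. qRe (hform (A k) (x j)))"
      using equalise_forms[where A = A and n = n and x = x, OF assms(1)] x unfolding Suc by metis
    have yk: "hform (A k) (y i) = of_real (minner (A k) X / real r)"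
      if "i < r" and k: "k \<in> {1..4}" for i k
    proof -
      have "real r * qRe (hform (A k) (y i)) = minner (A k) X"
        using y[OF that] assms(1)[OF k] by (simp add: x minner_sum minner_vouter)
      then have "qRe (hform (A k) (y i)) = minner (A k) X / real r"
        using Suc by (simp add: field_simps)
      \<comment> \<open>Forms of Hermitian matrices are real, so equality of real parts gives
        equality of quaternions.\<close>
      then show ?thesis using hform_real[OF assms(1)[OF k], of "y i"] by metis
    qed
    show ?thesis
    \<comment> \<open>Shifts the indices from 0, ..., r - 1 to 1, ..., r.\<close>
    proof (intro exI[of _ "\<lambda>i. y (i - 1)"] conjI ballI)
      show "X = (\<Sum>i = 1..r. vouter (y (i - 1)) (y (i - 1)))"
        unfolding ysum[symmetric]
        by (rule sum.reindex_bij_witness[of _ "\<lambda>i. i - 1" Suc]) auto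
    next
      fix i k :: nat assume "i \<in> {1..r}" "k \<in> {1..4}"
      then show "hform (A k) (y (i - 1)) = of_real (minner (A k) X / real r)"
        using yk[of "i - 1" k] by auto
    qed
  qed
qed

end
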